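(* Let $a,b,c$ be integers and $r,s,t$ real numbers, let $(V_n)_{n\ge 0}$ be the associated generalized Tribonacci sequence, and let $\varphi_n$ be the $n$th generalized Tribonacci hyperbolic spinor. Then for all $n\ge 3$, $$\varphi_{n}=r\varphi_{n-1}+s\varphi_{n-2}+t\varphi_{n-3}.$$
   Context: Hyperbolic numbers are the elements $x+yj$ with $x,y\in\mathbb{R}$ and $j^2=1$ (a commutative ring). A hyperbolic spinor is a column vector with two hyperbolic number components; addition and scalar multiplication are componentwise. Given integers $a,b,c$ and real numbers $r,s,t$, the generalized Tribonacci sequence $(V_n)_{n\ge0}$ is defined by $V_0=a$, $V_1=b$, $V_2=c$ and $V_n=rV_{n-1}+sV_{n-2}+tV_{n-3}$ for $n\ge 3$. The $n$th generalized Tribonacci hyperbolic spinor is $\varphi_n=\begin{bmatrix} V_n+V_{n+3}j\\ -V_{n+1}+V_{n+2}j\end{bmatrix}$, $n\ge 0$. *)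

theory Defs
  imports "HOL-Analysis.Cartesian_Space"
begin

datatype hyperbolic = Hyp (Re_hyp: real) (Im_hyp: real)

lemma hyperbolic_eq_iff: "z = w \<longleftrightarrow> Re_hyp z = Re_hyp w \<and> Im_hyp z = Im_hyp w"
  by (cases z; cases w) simp

instantiation hyperbolic :: "{comm_ring_1, real_algebra_1}"
begin

definition "0 = Hyp 0 0"
definition "1 = Hyp 1 0"
definition "z + w = Hyp (Re_hyp z + Re_hyp w) (Im_hyp z + Im_hyp w)"
definition "- z = Hyp (- Re_hyp z) (- Im_hyp z)"
definition "z - w = Hyp (Re_hyp z - Re_hyp w) (Im_hyp z - Im_hyp w)"
definition "z * w =
  Hyp (Re_hyp z * Re_hyp w + Im_hyp z * Im_hyp w) (Re_hyp z * Im_hyp w + Im_hyp z * Re_hyp w)"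
definition "scaleR k z = Hyp (k * Re_hyp z) (k * Im_hyp z)"

instance
  by intro_classes
    (simp_all add: zero_hyperbolic_def one_hyperbolic_def plus_hyperbolic_def
      uminus_hyperbolic_def minus_hyperbolic_def times_hyperbolic_def scaleR_hyperbolic_def
      hyperbolic_eq_iff algebra_simps)

end

definition hyp_j :: hyperbolic
  where "hyp_j = Hyp 0 1"

lemma hyp_j_squared: "hyp_j * hyp_j = 1"
  by (simp add: hyp_j_def times_hyperbolic_def one_hyperbolic_def)

lemma Hyp_eq: "Hyp x y = of_real x + of_real y * hyp_j"
  by (simp add: of_real_def hyp_j_def one_hyperbolic_def plus_hyperbolic_def
      times_hyperbolic_def scaleR_hyperbolic_def)

type_synonym hyperbolic_spinor = "hyperbolic ^ 2"

fun gen_tribonacci :: "int \<Rightarrow> int \<Rightarrow> int \<Rightarrow> real \<Rightarrow> real \<Rightarrow> real \<Rightarrow> nat \<Rightarrow> real" where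
  "gen_tribonacci a b c r s t 0 = of_int a"
| "gen_tribonacci a b c r s t (Suc 0) = of_int b"
| "gen_tribonacci a b c r s t (Suc (Suc 0)) = of_int c"
| "gen_tribonacci a b c r s t (Suc (Suc (Suc n))) =
     r * gen_tribonacci a b c r s t (Suc (Suc n))
     + s * gen_tribonacci a b c r s t (Suc n)
     + t * gen_tribonacci a b c r s t n"

definition gen_tribonacci_spinor ::
  "int \<Rightarrow> int \<Rightarrow> int \<Rightarrow> real \<Rightarrow> real \<Rightarrow> real \<Rightarrow> nat \<Rightarrow> hyperbolic_spinor" where
  "gen_tribonacci_spinor a b c r s t n =
    (let V = gen_tribonacci a b c r s t in
     vector [of_real (V n) + of_real (V (n + 3)) * hyp_j,
             - of_real (V (n + 1)) + of_real (V (n + 2)) * hyp_j])"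

end

theory Submission
  imports Defs
begin

text \<open>
  Each component of a spinor is a combination of terms of the sequence \<open>V\<close>, at fixed shifts of the
  index, with hyperbolic coefficients that do not depend on the index. Every shift of \<open>V\<close> satisfies
  the recurrence of \<open>V\<close>, and the solutions of a linear recurrence are closed under such combinations,
  because the real numbers \<open>r\<close>, \<open>s\<close>, \<open>t\<close> act centrally on the hyperbolic numbers.
\<close>

theorem theorem3p1:
  fixes a b c :: int and r s t :: real and n :: nat
  assumes "n \<ge> 3"
  shows "gen_tribonacci_spinor a b c r s t n =
    of_real r *s gen_tribonacci_spinor a b c r s t (n - 1)
    + of_real s *s gen_tribonacci_spinor a b c r s t (n - 2)
    + of_real t *s gen_tribonacci_spinor a b c r s t (n - 3)"
proof -
  define V where "V = gen_tribonacci a b c r s t"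
  define H :: "nat \<Rightarrow> hyperbolic" where "H k = of_real (V k)" for k
  have H_rec: "H k = of_real r * H (k - 1) + of_real s * H (k - 2) + of_real t * H (k - 3)"
    if "k \<ge> 3" for k
  proof -
    obtain i where "k = i + 3"
      using \<open>k \<ge> 3\<close> by (metis le_add_diff_inverse2)
    then show ?thesis
      by (simp add: H_def V_def numeral_eq_Suc)
  qed
  \<comment> \<open>The subtractions do not truncate since \<open>n \<ge> 3\<close>, so they commute with the shifts.\<close>
  have shift: "n - 1 + i = n + i - 1" "n - 2 + i = n + i - 2" "n - 3 + i = n + i - 3" for i
    using assms by simp_all
  have spinor_H: "gen_tribonacci_spinor a b c r s t k =
      vector [H k + H (k + 3) * hyp_j, - H (k + 1) + H (k + 2) * hyp_j]" for k
    by (simp add: gen_tribonacci_spinor_def H_def V_def Let_def)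
  \<comment> \<open>The first component uses the recurrence at \<open>n\<close> and \<open>n + 3\<close>, the second one at \<open>n + 1\<close> and
    \<open>n + 2\<close>.\<close>
  have "H n + H (n + 3) * hyp_j =
      of_real r * (H (n - 1) + H (n - 1 + 3) * hyp_j)
      + of_real s * (H (n - 2) + H (n - 2 + 3) * hyp_j)
      + of_real t * (H (n - 3) + H (n - 3 + 3) * hyp_j)"
    unfolding shift H_rec[OF assms] H_rec[OF trans_le_add1[OF assms, of 3]]
    by (simp only: distrib_left distrib_right mult.assoc ac_simps)
  moreover have "- H (n + 1) + H (n + 2) * hyp_j =
      of_real r * (- H (n - 1 + 1) + H (n - 1 + 2) * hyp_j)
      + of_real s * (- H (n - 2 + 1) + H (n - 2 + 2) * hyp_j)
      + of_real t * (- H (n - 3 + 1) + H (n - 3 + 2) * hyp_j)"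
    unfolding shift H_rec[OF trans_le_add1[OF assms, of 1]] H_rec[OF trans_le_add1[OF assms, of 2]]
    by (simp only: distrib_left distrib_right mult.assoc ac_simps minus_add_distrib mult_minus_right)
  ultimately show ?thesis
    unfolding vec_eq_iff forall_2 spinor_H
    by (simp only: vector_add_component vector_smult_component vector_2 simp_thms)
qed

end
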